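(* Let $\mathcal V^l_{W\dot W}$ be an LSG and let $\mathcal V_{W\dot W}$ be a genop such that $\mathcal V_{W\dot W}\supseteq\mathcal V^l_{W\dot W}$ and $\mathcal V_{W\dot W}\times\dot W=\mathcal V^l_{W\dot W}\times\dot W$. Let $\mathcal V_W$ be invariant in $\mathcal V^l_{W\dot W}$. Let $p,p_1,p_2$ be polynomials over $\mathbb F$. Then 1. $\mathcal V^l_{W\dot W}\cap\mathcal V_W=\mathcal V_{W\dot W}\cap(\mathcal V_W\oplus(\mathcal V_W)_{\dot W})$, and this space is a genop. 2. $\mathcal V_W$ is invariant in $\mathcal V_{W\dot W}$, and therefore $\mathcal V_{W\dot W}+(\mathcal V_W)_{\dot W}=\mathcal V_{W\dot W}+(\mathcal V_W\oplus(\mathcal V_W)_{\dot W})$ and $\mathcal V_{W\dot W}+(\mathcal V_W)_{\dot W}$ is a genop. 3. $p(\mathcal V^l_{W\dot W}\cap\mathcal V_W)=p(\mathcal V_{W\dot W})\cap(\mathcal V_W\oplus(\mathcal V_W)_{\dot W})$. 4. $p(\mathcal V_{W\dot W}+(\mathcal V_W)_{\dot W})=p(\mathcal V_{W\dot W})+(\mathcal V_W)_{\dot W}=p(\mathcal V_{W\dot W})+(\mathcal V_W\oplus(\mathcal V_W)_{\dot W})$. 5. If $p(\mathcal V_{W\dot W})$ is decoupled, so are $p(\mathcal V^l_{W\dot W}\cap\mathcal V_W)$ and $p(\mathcal V_{W\dot W}+(\mathcal V_W)_{\dot W})$. 6. If $p_1(\mathcal V^l_{W\dot W}\cap\mathcal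 V_W)$ and $p_2(\mathcal V_{W\dot W}+(\mathcal V_W)_{\dot W})$ are decoupled, then $(p_1p_2)(\mathcal V_{W\dot W})$ is decoupled.
   Context: Fix a field $\mathbb F$; all index sets are finite. A vector on $X$ is a function $X\to\mathbb F$. $W,\dot W$ are disjoint sets that are copies of each other (in bijection); subscripts such as $(\mathcal V_W)_{\dot W}$, $(\mathcal V_{W\dot W})_{WW_1}$ denote relabelling of index sets along bijections. A genaut $\mathcal V_{W\dot W}$ is a linear subspace of vectors $(f_W,g_{\dot W})$ on $W\uplus\dot W$. For spaces on different index sets: $\mathcal V_X+\mathcal V_Y$ is on $X\cup Y$, formed after extending vectors by zero (so $\mathcal V_{W\dot W}+(\mathcal V_W)_{\dot W}=\mathcal V_{W\dot W}+(0_W\oplus(\mathcal V_W)_{\dot W})$); $\mathcal V_X\cap\mathcal V_Y$ is the set of vectors on $X\cup Y$ whose restrictions to $X$, $Y$ lie in $\mathcal V_X$, $\mathcal V_Y$ (so $\mathcal V_{W\dot W}\cap\mathcal V_W=\{(f_W,g_{\dot W})\in\mathcal V_{W\dot W}:f_W\in\mathcal V_W\}$). $\mathcal V_{XY}\circ X:=\{f_X:(f_X,g_Y)\in\mathcal V_{XY}\text{ for some }g_Y\}$, $\mathcal V_{XY}\times X:=\{f_X:(f_X,0_Y)\in\mathcal V_{XY}\}$, $\mathcal V_{XY}\leftrightarrow\mathcal V_{YZ}:=\{(f_X,h_Z):\exists g_Y,(f_X,g_Y)\in\mathcal V_{XY},(g_Y,h_Z)\in\mathcal V_{YZ}\}$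 (also with $Z$ empty). A genaut is a USG if $\mathcal V_{W\dot W}\circ W\supseteq(\mathcal V_{W\dot W}\circ\dot W)_W$; an LSG if $\mathcal V_{W\dot W}\times W\supseteq(\mathcal V_{W\dot W}\times\dot W)_W$; a genop if both. $\mathcal V_W$ is invariant in $\mathcal V_{W\dot W}$ iff it is conditioned invariant, $\mathcal V_{W\dot W}\leftrightarrow\mathcal V_W\subseteq(\mathcal V_W)_{\dot W}$, and controlled invariant, $\mathcal V_{W\dot W}\leftrightarrow(\mathcal V_W)_{\dot W}\supseteq\mathcal V_W$. A space on $W\uplus\dot W$ is decoupled if it has the form $\mathcal V^1_W\oplus\mathcal V^2_{\dot W}$. Polynomials of genauts: $\mathcal V^1_{W\dot W}+_{\dot w}\mathcal V^2_{W\dot W}:=\{(f_W,g^1_{\dot W}+g^2_{\dot W}):(f_W,g^i_{\dot W})\in\mathcal V^i_{W\dot W}\}$; $\lambda^{\dot w}\mathcal V_{W\dot W}:=\{(f_W,\lambda g_{\dot W}):(f_W,g_{\dot W})\in\mathcal V_{W\dot W}\}+(0_W\oplus\mathcal V_{W\dot W}\times\dot W)$; $\mathcal V^1_{W\dot W}*\mathcal V^2_{W\dot W}:=(\mathcal V^1_{W\dot W})_{WW_1}\leftrightarrow(\mathcal V^2_{W\dot W})_{W_1\dot W}$ with $W_1$ a disjoint dummy copy of $W$; $\mathcal V^{(0)}_{W\dot W}:=I_{W\dot W}+_{\dot w}[\mathcal V_{W\dot W}\circ W\oplus\mathcal V_{W\dot W}\times\dot W]$ with $I_{W\dot W}=\{(f_W,f_{\dot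 W})\}$ ($f_{\dot W}$ the copy of $f_W$); $\mathcal V^{(1)}_{W\dot W}:=\mathcal V_{W\dot W}$; $\mathcal V^{(k)}_{W\dot W}:=\mathcal V^{(k-1)}_{W\dot W}*\mathcal V_{W\dot W}$. For $p(s)=\sum_{i=0}^n\alpha_is^i$, $p(\mathcal V_{W\dot W}):=\alpha_0^{\dot w}\mathcal V^{(0)}_{W\dot W}+_{\dot w}\cdots+_{\dot w}\alpha_n^{\dot w}\mathcal V^{(n)}_{W\dot W}$. *)

theory Defs
  imports
    "HOL-Library.Function_Algebras"
    "HOL-Library.Product_Plus"
    "HOL-Library.Set_Algebras"
    "HOL-Computational_Algebra.Polynomial"
begin

text \<open>
  A vector on the index set \<open>X\<close> is represented by its extension by zero to the whole index type.
  A vector on the disjoint union of \<open>W\<close> and its copy is the pair \<open>(f, g)\<close> of its restrictions, where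
  the second component is indexed by \<open>W\<close> again: relabelling along the bijection between \<open>W\<close> and
  its copy is thereby the identity.  Sums of vectors, pairs and sets of pairs are the library's.
\<close>

definition vectors_on :: "'i set \<Rightarrow> ('i \<Rightarrow> 'a::field) set" where
  "vectors_on X = {f. \<forall>i. i \<notin> X \<longrightarrow> f i = 0}"

definition vscale :: "'a::field \<Rightarrow> ('i \<Rightarrow> 'a) \<Rightarrow> ('i \<Rightarrow> 'a)" where
  "vscale c f = (\<lambda>i. c * f i)"

definition pscale :: "'a::field \<Rightarrow> ('i \<Rightarrow> 'a) \<times> ('i \<Rightarrow> 'a) \<Rightarrow> ('i \<Rightarrow> 'a) \<times> ('i \<Rightarrow> 'a)" where
  "pscale c v = (vscale c (fst v), vscale c (snd v))"

global_interpretation vec: vector_space "vscale :: 'a::field \<Rightarrow> ('i \<Rightarrow> 'a) \<Rightarrow> ('i \<Rightarrow> 'a)"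
  by unfold_locales (auto simp: vscale_def fun_eq_iff algebra_simps)

global_interpretation pvec: vector_space
    "pscale :: 'a::field \<Rightarrow> ('i \<Rightarrow> 'a) \<times> ('i \<Rightarrow> 'a) \<Rightarrow> ('i \<Rightarrow> 'a) \<times> ('i \<Rightarrow> 'a)"
  by unfold_locales
    (auto simp: pscale_def vec.scale_right_distrib vec.scale_left_distrib prod_eq_iff)

definition space_on :: "'i set \<Rightarrow> ('i \<Rightarrow> 'a::field) set \<Rightarrow> bool" where
  "space_on W U \<longleftrightarrow> U \<subseteq> vectors_on W \<and> vec.subspace U"

type_synonym ('i, 'a) genaut = "(('i \<Rightarrow> 'a) \<times> ('i \<Rightarrow> 'a)) set"

definition is_genaut :: "'i set \<Rightarrow> ('i, 'a::field) genaut \<Rightarrow> bool" where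
  "is_genaut W V \<longleftrightarrow> V \<subseteq> vectors_on W \<times> vectors_on W \<and> pvec.subspace V"

text \<open>
  The projections \<open>\<V> \<circ> W\<close> and \<open>\<V> \<circ> \<close>(copy of \<open>W\<close>) are \<^const>\<open>Domain\<close> and \<^const>\<open>Range\<close>; the
  restrictions \<open>\<V> \<times> W\<close> and \<open>\<V> \<times> \<close>(copy of \<open>W\<close>) are the following.
\<close>

definition kerW :: "('i, 'a::field) genaut \<Rightarrow> ('i \<Rightarrow> 'a) set" where
  "kerW V = {f. (f, 0) \<in> V}"

definition kerD :: "('i, 'a::field) genaut \<Rightarrow> ('i \<Rightarrow> 'a) set" where
  "kerD V = {g. (0, g) \<in> V}"

definition USG :: "'i set \<Rightarrow> ('i, 'a::field) genaut \<Rightarrow> bool" where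
  "USG W V \<longleftrightarrow> is_genaut W V \<and> Range V \<subseteq> Domain V"

definition LSG :: "'i set \<Rightarrow> ('i, 'a::field) genaut \<Rightarrow> bool" where
  "LSG W V \<longleftrightarrow> is_genaut W V \<and> kerD V \<subseteq> kerW V"

definition genop :: "'i set \<Rightarrow> ('i, 'a::field) genaut \<Rightarrow> bool" where
  "genop W V \<longleftrightarrow> USG W V \<and> LSG W V"

text \<open>
  The composition of a genaut with a space on \<open>W\<close>, respectively on the copy of \<open>W\<close>, is the image
  of that space under the relation, respectively under its converse.
\<close>

definition cond_invariant :: "('i \<Rightarrow> 'a::field) set \<Rightarrow> ('i, 'a) genaut \<Rightarrow> bool" where
  "cond_invariant U V \<longleftrightarrow> V `` U \<subseteq> U"

definition ctrl_invariant :: "('i \<Rightarrow> 'a::field) set \<Rightarrow> ('i, 'a) genaut \<Rightarrow> bool" where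
  "ctrl_invariant U V \<longleftrightarrow> U \<subseteq> V\<inverse> `` U"

definition invariant_in :: "'i set \<Rightarrow> ('i \<Rightarrow> 'a::field) set \<Rightarrow> ('i, 'a) genaut \<Rightarrow> bool" where
  "invariant_in W U V \<longleftrightarrow> space_on W U \<and> cond_invariant U V \<and> ctrl_invariant U V"

definition decoupled :: "'i set \<Rightarrow> ('i, 'a::field) genaut \<Rightarrow> bool" where
  "decoupled W V \<longleftrightarrow> (\<exists>U1 U2. space_on W U1 \<and> space_on W U2 \<and> V = U1 \<times> U2)"

text \<open>Intersection of a genaut with a space on \<open>W\<close>, and sum with a space on the copy of \<open>W\<close>.\<close>

definition meetW :: "('i, 'a::field) genaut \<Rightarrow> ('i \<Rightarrow> 'a) set \<Rightarrow> ('i, 'a) genaut" where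
  "meetW V U = {(f, g). (f, g) \<in> V \<and> f \<in> U}"

definition plusD :: "('i, 'a::field) genaut \<Rightarrow> ('i \<Rightarrow> 'a) set \<Rightarrow> ('i, 'a) genaut" where
  "plusD V U = V + {0} \<times> U"

definition genaut_add :: "('i, 'a::field) genaut \<Rightarrow> ('i, 'a) genaut \<Rightarrow> ('i, 'a) genaut" where
  "genaut_add V1 V2 = {(f, g1 + g2) | f g1 g2. (f, g1) \<in> V1 \<and> (f, g2) \<in> V2}"

definition genaut_scale :: "'a::field \<Rightarrow> ('i, 'a) genaut \<Rightarrow> ('i, 'a) genaut" where
  "genaut_scale c V = {(f, vscale c g) | f g. (f, g) \<in> V} + {0} \<times> kerD V"

text \<open>The product of genauts is the library's relational composition.\<close>

fun genaut_power :: "'i set \<Rightarrow> ('i, 'a::field) genaut \<Rightarrow> nat \<Rightarrow> ('i, 'a) genaut" where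
  "genaut_power W V 0 = genaut_add (Id_on (vectors_on W)) (Domain V \<times> kerD V)"
| "genaut_power W V (Suc 0) = V"
| "genaut_power W V (Suc (Suc k)) = genaut_power W V (Suc k) O V"

primrec genaut_poly_upto ::
    "'i set \<Rightarrow> 'a::field poly \<Rightarrow> ('i, 'a) genaut \<Rightarrow> nat \<Rightarrow> ('i, 'a) genaut" where
  "genaut_poly_upto W p V 0 = genaut_scale (coeff p 0) (genaut_power W V 0)"
| "genaut_poly_upto W p V (Suc n) =
     genaut_add (genaut_poly_upto W p V n)
       (genaut_scale (coeff p (Suc n)) (genaut_power W V (Suc n)))"

text \<open>The sum runs over all \<open>i \<le> degree p\<close>; for \<open>p = 0\<close> it consists of the term \<open>i = 0\<close> only.\<close>

definition genaut_poly :: "'i set \<Rightarrow> 'a::field poly \<Rightarrow> ('i, 'a) genaut \<Rightarrow> ('i, 'a) genaut" where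
  "genaut_poly W p V = genaut_poly_upto W p V (degree p)"

end

theory Submission
  imports Defs
begin

text \<open>
  A genop \<open>V\<close> is a linear operator on the quotient \<open>D / K\<close> in disguise, where \<open>D\<close> is its projection
  on \<open>W\<close> and \<open>K\<close> its restriction to the copy of \<open>W\<close>: the second component of a pair in \<open>V\<close> is
  determined by the first one modulo \<open>K\<close> (as \<open>V\<close> is linear), it lies in \<open>D\<close> (USG), and it is zero
  modulo \<open>K\<close> for first components in \<open>K\<close> (LSG).  Lifting that operator to a linear map \<open>t\<close> on all
  vectors (\<open>genop_as_graph_mod\<close>) gives \<open>V = graph_mod D t K\<close>, with \<open>D\<close> and \<open>K\<close> invariant under \<open>t\<close>.

  The point of the hypotheses is that \<open>K \<subseteq> U \<subseteq> D\<close>, that \<open>U\<close> is invariant under the same \<open>t\<close>,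
  and that the two derived genauts also come from \<open>t\<close>: the meet with \<open>U\<close> is \<open>graph_mod U t K\<close>, the
  operator induced on \<open>U / K\<close>, and the sum with \<open>U\<close> is \<open>graph_mod D t U\<close>, the operator induced on
  \<open>D / U\<close>.  A polynomial \<open>p\<close> in a genop replaces \<open>t\<close> by \<open>p(t)\<close> and leaves the two spaces unchanged
  (\<open>genaut_poly_graph_mod\<close>), so the identities between polynomials reduce to identities between
  graphs of one map modulo different spaces.  Finally, \<open>graph_mod A s B\<close> is decoupled exactly when
  \<open>s\<close> is zero from \<open>A\<close> to the quotient by \<open>B\<close>, that is, \<open>s ` A \<subseteq> B\<close> (\<open>decoupled_graph_mod_iff\<close>).
  Hence the last two parts say that an annihilating polynomial of \<open>D / K\<close> annihilates \<open>U / K\<close> and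
  \<open>D / U\<close>, and that \<open>p\<^sub>1(t)\<close> mapping \<open>U\<close> to \<open>K\<close> and \<open>p\<^sub>2(t)\<close> mapping \<open>D\<close> to \<open>U\<close> make
  \<open>p\<^sub>1(t) \<circ> p\<^sub>2(t) = (p\<^sub>1 p\<^sub>2)(t)\<close> map \<open>D\<close> to \<open>K\<close>.
\<close>

section \<open>Graphs of maps modulo a subspace\<close>

definition graph_mod ::
    "('i \<Rightarrow> 'a::field) set \<Rightarrow> (('i \<Rightarrow> 'a) \<Rightarrow> ('i \<Rightarrow> 'a)) \<Rightarrow> ('i \<Rightarrow> 'a) set \<Rightarrow> ('i, 'a) genaut" where
  "graph_mod A s B = {(f, g). f \<in> A \<and> g - s f \<in> B}"

abbreviation vlinear :: "(('i \<Rightarrow> 'a::field) \<Rightarrow> ('i \<Rightarrow> 'a)) \<Rightarrow> bool" where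
  "vlinear \<equiv> Vector_Spaces.linear vscale vscale"

lemma mem_graph_mod [simp]: "(f, g) \<in> graph_mod A s B \<longleftrightarrow> f \<in> A \<and> g - s f \<in> B"
  by (simp add: graph_mod_def)

lemma Domain_graph_mod:
  assumes "vec.subspace B"
  shows "Domain (graph_mod A s B) = A"
proof -
  have "(f, s f) \<in> graph_mod A s B" if "f \<in> A" for f
    using that assms by (simp add: vec.subspace_0)
  then show ?thesis
    unfolding graph_mod_def by blast
qed

lemma vlinear_0: "vlinear s \<Longrightarrow> s 0 = 0"
  unfolding Vector_Spaces.linear_def by (blast dest: module_hom.zero)

lemma kerD_graph_mod:
  assumes "vec.subspace A" "vlinear s"
  shows "kerD (graph_mod A s B) = B"
  by (simp add: kerD_def vec.subspace_0[OF assms(1)] vlinear_0[OF assms(2)])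

lemma subspace_kerD:
  assumes "pvec.subspace V"
  shows "vec.subspace (kerD V)"
  unfolding vec.subspace_def
proof (intro conjI ballI allI)
  show "0 \<in> kerD V"
    using pvec.subspace_0[OF assms] by (simp add: kerD_def zero_prod_def)
next
  fix x y assume "x \<in> kerD V" "y \<in> kerD V"
  then show "x + y \<in> kerD V"
    using pvec.subspace_add[OF assms, of "(0, x)" "(0, y)"] by (simp add: kerD_def)
next
  fix c x assume "x \<in> kerD V"
  then show "vscale c x \<in> kerD V"
    using pvec.subspace_scale[OF assms, of "(0, x)" c] by (simp add: kerD_def pscale_def)
qed

lemma subspace_Domain:
  assumes "pvec.subspace V"
  shows "vec.subspace (Domain V)"
  unfolding vec.subspace_def
proof (intro conjI ballI allI)
  show "0 \<in> Domain V"
    using pvec.subspace_0[OF assms] by (auto simp: zero_prod_def)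
next
  fix x y assume "x \<in> Domain V" "y \<in> Domain V"
  then obtain x' y' where "(x, x') \<in> V" "(y, y') \<in> V"
    by blast
  then have "(x, x') + (y, y') \<in> V"
    by (rule pvec.subspace_add[OF assms])
  then show "x + y \<in> Domain V"
    by auto
next
  fix c x assume "x \<in> Domain V"
  then obtain x' where "(x, x') \<in> V"
    by blast
  then have "pscale c (x, x') \<in> V"
    by (rule pvec.subspace_scale[OF assms])
  then show "vscale c x \<in> Domain V"
    by (auto simp: pscale_def)
qed

lemma diff_in_kerD:
  assumes "pvec.subspace V" "(f, g) \<in> V" "(f, g') \<in> V"
  shows "g - g' \<in> kerD V"
  using pvec.subspace_diff[OF assms] by (simp add: kerD_def)

lemma subspace_graph_mod:
  assumes A: "vec.subspace A" and B: "vec.subspace B" and s: "vlinear s"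
  shows "pvec.subspace (graph_mod A s B)"
proof -
  interpret s: Vector_Spaces.linear vscale vscale s
    by (rule s)
  show ?thesis
    unfolding pvec.subspace_def
  proof (intro conjI ballI allI)
    show "0 \<in> graph_mod A s B"
      by (simp add: zero_prod_def s.zero A B vec.subspace_0)
  next
    fix x y assume "x \<in> graph_mod A s B" "y \<in> graph_mod A s B"
    then obtain f g f' g' where xy: "x = (f, g)" "y = (f', g')"
      and "f \<in> A" "f' \<in> A" "g - s f \<in> B" "g' - s f' \<in> B"
      by (cases x, cases y) auto
    then have "f + f' \<in> A" "(g - s f) + (g' - s f') \<in> B"
      by (blast intro: vec.subspace_add[OF A] vec.subspace_add[OF B])+
    moreover have "(g - s f) + (g' - s f') = g + g' - s (f + f')"
      by (simp add: s.add)
    ultimately show "x + y \<in> graph_mod A s B"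
      by (simp only: xy add_Pair mem_graph_mod)
  next
    fix c x assume "x \<in> graph_mod A s B"
    then obtain f g where x: "x = (f, g)" and "f \<in> A" "g - s f \<in> B"
      by (cases x) auto
    moreover have "vscale c g - s (vscale c f) = vscale c (g - s f)"
      by (simp add: s.scale vec.scale_right_diff_distrib)
    ultimately show "pscale c x \<in> graph_mod A s B"
      by (simp add: pscale_def vec.subspace_scale[OF A] vec.subspace_scale[OF B])
  qed
qed

lemma graph_mod_range:
  assumes "space_on W A" "space_on W B" "B \<subseteq> A" "s ` A \<subseteq> A" "(f, g) \<in> graph_mod A s B"
  shows "g \<in> A"
proof -
  have A: "vec.subspace A"
    using assms by (simp add: space_on_def)
  have "g - s f \<in> A" "s f \<in> A"
    using assms by auto
  then have "(g - s f) + s f \<in> A"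
    by (rule vec.subspace_add[OF A])
  then show ?thesis
    by simp
qed

lemma genop_graph_mod:
  assumes A: "space_on W A" and B: "space_on W B" and "B \<subseteq> A"
    and s: "vlinear s" and sA: "s ` A \<subseteq> A" and sB: "s ` B \<subseteq> B"
  shows "genop W (graph_mod A s B)"
proof -
  have subs: "vec.subspace A" "vec.subspace B"
    using A B by (auto simp: space_on_def)
  have closed: "g \<in> A" if "(f, g) \<in> graph_mod A s B" for f g
    using graph_mod_range[OF A B \<open>B \<subseteq> A\<close> sA that] .
  have "graph_mod A s B \<subseteq> vectors_on W \<times> vectors_on W"
    using closed A by (auto simp: space_on_def)
  then have "is_genaut W (graph_mod A s B)"
    using subspace_graph_mod[OF subs s] by (simp add: is_genaut_def)
  moreover have "Range (graph_mod A s B) \<subseteq> Domain (graph_mod A s B)"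
    using closed by (auto simp: Domain_graph_mod subs)
  moreover have "kerD (graph_mod A s B) \<subseteq> kerW (graph_mod A s B)"
    using \<open>B \<subseteq> A\<close> sB vec.subspace_neg[OF subs(2)]
    by (auto simp: kerD_graph_mod subs s kerW_def)
  ultimately show ?thesis
    by (simp add: genop_def USG_def LSG_def)
qed

text \<open>
  A linear map inside \<open>V\<close> exists because the values on a basis of the domain can be chosen
  freely among the second components available there, and linearity of \<open>V\<close> carries the choice over to the span.
\<close>

lemma linear_selection:
  fixes V :: "('i, 'a::field) genaut"
  assumes V: "pvec.subspace V"
  obtains t where "vlinear t" "\<And>f. f \<in> Domain V \<Longrightarrow> (f, t f) \<in> V"
proof -
  interpret vector_space_pair "vscale :: 'a \<Rightarrow> ('i \<Rightarrow> 'a) \<Rightarrow> _" "vscale :: 'a \<Rightarrow> ('i \<Rightarrow> 'a) \<Rightarrow> _"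
    by unfold_locales
  obtain B where B: "B \<subseteq> Domain V" "vec.independent B" "Domain V \<subseteq> vec.span B"
    by (rule vec.maximal_independent_subset)
  have "\<forall>b\<in>B. \<exists>y. (b, y) \<in> V"
    using B(1) by (simp add: subset_iff Domain_iff)
  then have "\<exists>g. \<forall>b\<in>B. (b, g b) \<in> V"
    by (rule bchoice)
  then obtain g where g: "\<And>b. b \<in> B \<Longrightarrow> (b, g b) \<in> V"
    by blast
  obtain t where t: "vlinear t" and tB: "\<And>b. b \<in> B \<Longrightarrow> t b = g b"
    using linear_independent_extend[OF B(2), of g] by blast
  interpret t: Vector_Spaces.linear vscale vscale t
    by (rule t)
  have "(f, t f) \<in> V" if "f \<in> vec.span B" for f
    using that
  proof (induction rule: vec.span_induct_alt)
    case base
    then show ?case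
      using pvec.subspace_0[OF V] unfolding zero_prod_def t.zero .
  next
    case (step c b f)
    have "pscale c (b, t b) + (f, t f) \<in> V"
      using step g tB by (intro pvec.subspace_add[OF V] pvec.subspace_scale[OF V]) auto
    then show ?case
      unfolding pscale_def fst_conv snd_conv add_Pair t.add t.scale .
  qed
  with t B(3) show ?thesis
    by (intro that[of t]) auto
qed

text \<open>
  The converse of \<open>genop_graph_mod\<close>: the USG condition becomes invariance of the projection under
  the lifted map, and the LSG condition becomes invariance of the restriction.
\<close>

lemma genop_as_graph_mod:
  assumes "genop W V"
  obtains t where "vlinear t" "V = graph_mod (Domain V) t (kerD V)"
    "t ` Domain V \<subseteq> Domain V" "t ` kerD V \<subseteq> kerD V"
proof -
  have V: "pvec.subspace V" and range: "Range V \<subseteq> Domain V" and ker: "kerD V \<subseteq> kerW V"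
    using assms by (auto simp: genop_def USG_def LSG_def is_genaut_def)
  obtain t where t: "vlinear t" and tV: "\<And>f. f \<in> Domain V \<Longrightarrow> (f, t f) \<in> V"
    using linear_selection[OF V] by blast
  have "V = graph_mod (Domain V) t (kerD V)"
  proof (intro set_eqI iffI; clarify)
    fix f g assume "(f, g) \<in> V"
    then show "(f, g) \<in> graph_mod (Domain V) t (kerD V)"
      using diff_in_kerD[OF V, of f g "t f"] tV by auto
  next
    fix f g assume "(f, g) \<in> graph_mod (Domain V) t (kerD V)"
    then have "(f, t f) + (0, g - t f) \<in> V"
      using tV by (intro pvec.subspace_add[OF V]) (auto simp: kerD_def)
    then show "(f, g) \<in> V"
      by simp
  qed
  moreover have "t ` Domain V \<subseteq> Domain V"
    using tV range by blast
  moreover have "t k \<in> kerD V" if "k \<in> kerD V" for k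
  proof -
    have "(k, 0) \<in> V"
      using that ker by (auto simp: kerW_def)
    then show ?thesis
      using diff_in_kerD[OF V, of k "t k" 0] tV by auto
  qed
  ultimately show ?thesis
    using that[OF t] by blast
qed

text \<open>A product that contains \<open>(f, s f)\<close> and \<open>(0, 0)\<close> contains \<open>(0, s f)\<close>, which forces \<open>s f\<close> into \<open>B\<close>.\<close>

lemma decoupled_graph_mod_iff:
  assumes A: "space_on W A" and B: "space_on W B" and s: "vlinear s"
  shows "decoupled W (graph_mod A s B) \<longleftrightarrow> s ` A \<subseteq> B"
proof -
  have subs: "vec.subspace A" "vec.subspace B"
    using A B by (auto simp: space_on_def)
  interpret s: Vector_Spaces.linear vscale vscale s
    by (rule s)
  show ?thesis
  proof
    assume "decoupled W (graph_mod A s B)"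
    then obtain U1 U2 where eq: "graph_mod A s B = U1 \<times> U2"
      by (auto simp: decoupled_def)
    have "s f \<in> B" if "f \<in> A" for f
    proof -
      have "(f, s f) \<in> graph_mod A s B" "(0, 0) \<in> graph_mod A s B"
        using that subs by (simp_all add: vec.subspace_0 s.zero)
      then have "(0, s f) \<in> graph_mod A s B"
        unfolding eq by blast
      then show ?thesis
        by (simp add: s.zero)
    qed
    then show "s ` A \<subseteq> B"
      by blast
  next
    assume sA: "s ` A \<subseteq> B"
    have "g - s f \<in> B \<longleftrightarrow> g \<in> B" if "f \<in> A" for f g
    proof -
      have sf: "s f \<in> B"
        using that sA by blast
      show ?thesis
        using vec.subspace_diff[OF subs(2) _ sf] vec.subspace_add[OF subs(2) _ sf]
        by (metis diff_add_cancel)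
    qed
    then have "graph_mod A s B = A \<times> B"
      by auto
    then show "decoupled W (graph_mod A s B)"
      using A B by (auto simp: decoupled_def)
  qed
qed

section \<open>Polynomials of a graph modulo a subspace\<close>

definition poly_op ::
    "'a::field poly \<Rightarrow> (('i \<Rightarrow> 'a) \<Rightarrow> ('i \<Rightarrow> 'a)) \<Rightarrow> ('i \<Rightarrow> 'a) \<Rightarrow> ('i \<Rightarrow> 'a)" where
  "poly_op p t f = (\<Sum>i\<le>degree p. vscale (coeff p i) ((t ^^ i) f))"

lemma poly_op_upto:
  assumes "degree p \<le> n"
  shows "poly_op p t f = (\<Sum>i\<le>n. vscale (coeff p i) ((t ^^ i) f))"
  unfolding poly_op_def
  using assms by (intro sum.mono_neutral_left) (auto simp: coeff_eq_0)

lemma poly_op_0 [simp]: "poly_op 0 t f = 0"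
  by (simp add: poly_op_def)

lemma poly_op_pCons: "poly_op (pCons a p) t f = vscale a f + poly_op p t (t f)"
proof -
  have "poly_op (pCons a p) t f
      = (\<Sum>i\<le>Suc (degree p). vscale (coeff (pCons a p) i) ((t ^^ i) f))"
    by (rule poly_op_upto) (simp add: degree_pCons_le)
  then show ?thesis
    by (simp add: sum.atMost_Suc_shift poly_op_def funpow_swap1 del: sum.atMost_Suc)
qed

lemma poly_op_smult: "poly_op (smult c p) t f = vscale c (poly_op p t f)"
  by (simp add: poly_op_upto[OF degree_smult_le] poly_op_def[of p] vec.scale_sum_right)

lemma poly_op_add: "poly_op (p + q) t f = poly_op p t f + poly_op q t f"
proof -
  let ?n = "max (degree p) (degree q)"
  show ?thesis
    by (simp add: poly_op_upto[of _ ?n] degree_add_le_max vec.scale_left_distrib sum.distrib)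
qed

lemma vlinear_funpow:
  assumes "vlinear t"
  shows "vlinear (t ^^ i)"
proof (induction i)
  case 0
  show ?case
    unfolding funpow.simps by (rule vec.linear_id)
next
  case (Suc i)
  then show ?case
    unfolding funpow.simps by (rule Vector_Spaces.linear_compose[OF _ assms])
qed

lemma vlinear_poly_op:
  assumes "vlinear t"
  shows "vlinear (poly_op p t)"
proof -
  interpret vector_space_pair vscale vscale
    by unfold_locales
  have "vlinear (t ^^ i)" for i
    by (rule vlinear_funpow[OF assms])
  then have "vlinear (\<lambda>f. \<Sum>i\<le>degree p. vscale (coeff p i) ((t ^^ i) f))"
    by (intro linear_compose_sum ballI linear_compose_scale_right) auto
  then show ?thesis
    by (simp add: poly_op_def[abs_def])
qed

text \<open>
  Linearity of \<open>t\<close> makes it commute with \<open>poly_op q t\<close>.  This is why the proof lifts the operator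
  on the quotient to a linear map: for an arbitrary lift the equation holds only modulo its indeterminacy.
\<close>

lemma poly_op_mult:
  assumes "vlinear t"
  shows "poly_op (p * q) t f = poly_op p t (poly_op q t f)"
proof (induction p arbitrary: f)
  case (pCons a p)
  interpret t: Vector_Spaces.linear vscale vscale t
    by (rule assms)
  have "t (poly_op q t f) = poly_op q t (t f)"
    by (simp add: poly_op_def t.sum t.scale funpow_swap1)
  then show ?case
    using pCons.IH
    by (simp add: poly_op_add poly_op_smult poly_op_pCons)
qed simp

lemma poly_op_closed:
  assumes "vec.subspace A" "t ` A \<subseteq> A"
  shows "poly_op p t ` A \<subseteq> A"
proof -
  have "(t ^^ i) f \<in> A" if "f \<in> A" for i f
    using that assms(2) by (induction i) auto
  then show ?thesis
    using assms(1) by (auto simp: poly_op_def intro!: vec.subspace_sum vec.subspace_scale)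
qed

lemma genaut_add_graph_mod:
  assumes "vec.subspace B"
  shows "genaut_add (graph_mod A s B) (graph_mod A s' B) = graph_mod A (\<lambda>f. s f + s' f) B"
proof (intro set_eqI iffI; clarify)
  fix f g assume "(f, g) \<in> genaut_add (graph_mod A s B) (graph_mod A s' B)"
  then obtain g1 g2 where g: "g = g1 + g2" and "f \<in> A" and *: "g1 - s f \<in> B" "g2 - s' f \<in> B"
    by (auto simp: genaut_add_def)
  have "(g1 - s f) + (g2 - s' f) = g - (s f + s' f)"
    by (simp add: g)
  then show "(f, g) \<in> graph_mod A (\<lambda>f. s f + s' f) B"
    using vec.subspace_add[OF assms *] \<open>f \<in> A\<close> by (simp only: mem_graph_mod)
next
  fix f g assume "(f, g) \<in> graph_mod A (\<lambda>f. s f + s' f) B"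
  then have "(f, s f) \<in> graph_mod A s B" "(f, g - s f) \<in> graph_mod A s' B"
    by (simp_all add: vec.subspace_0[OF assms] diff_diff_eq)
  then have "(f, s f + (g - s f)) \<in> genaut_add (graph_mod A s B) (graph_mod A s' B)"
    unfolding genaut_add_def by blast
  then show "(f, g) \<in> genaut_add (graph_mod A s B) (graph_mod A s' B)"
    by simp
qed

lemma genaut_scale_graph_mod:
  assumes A: "vec.subspace A" and B: "vec.subspace B" and s: "vlinear s"
  shows "genaut_scale c (graph_mod A s B) = graph_mod A (\<lambda>f. vscale c (s f)) B"
proof (intro set_eqI iffI; clarify)
  fix f g assume "(f, g) \<in> genaut_scale c (graph_mod A s B)"
  then obtain h k where g: "g = vscale c h + k" and "f \<in> A" and *: "h - s f \<in> B" "k \<in> B"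
    unfolding genaut_scale_def kerD_graph_mod[OF A s]
    by (auto simp: set_plus_def)
  have "g - vscale c (s f) = vscale c (h - s f) + k"
    by (simp add: g vec.scale_right_diff_distrib)
  then show "(f, g) \<in> graph_mod A (\<lambda>f. vscale c (s f)) B"
    using vec.subspace_add[OF B vec.subspace_scale[OF B *(1)] *(2)] \<open>f \<in> A\<close> by simp
next
  fix f g assume "(f, g) \<in> graph_mod A (\<lambda>f. vscale c (s f)) B"
  then have "(f, s f) \<in> graph_mod A s B" "g - vscale c (s f) \<in> B"
    by (auto simp: vec.subspace_0[OF B])
  then have "(f, vscale c (s f)) + (0, g - vscale c (s f)) \<in> genaut_scale c (graph_mod A s B)"
    unfolding genaut_scale_def kerD_graph_mod[OF A s]
    by (intro set_plus_intro) blast+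
  then show "(f, g) \<in> genaut_scale c (graph_mod A s B)"
    by simp
qed

text \<open>
  Here both invariance conditions enter: a middle vector differs from \<open>s f\<close> by an element of \<open>B\<close>,
  so it stays in \<open>A\<close> and its image under \<open>t\<close> changes by an element of \<open>B\<close> only.
\<close>

lemma graph_mod_O:
  assumes A: "vec.subspace A" and B: "vec.subspace B" and "B \<subseteq> A"
    and t: "vlinear t" and tB: "t ` B \<subseteq> B" and sA: "s ` A \<subseteq> A"
  shows "graph_mod A s B O graph_mod A t B = graph_mod A (\<lambda>f. t (s f)) B"
proof (intro set_eqI iffI; clarify)
  interpret t: Vector_Spaces.linear vscale vscale t
    by (rule t)
  fix f h g assume "(f, h) \<in> graph_mod A s B" "(h, g) \<in> graph_mod A t B"
  then have *: "f \<in> A" "t (h - s f) \<in> B" "g - t h \<in> B"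
    using tB by auto
  have "(g - t h) + t (h - s f) = g - t (s f)"
    by (simp add: t.diff)
  then show "(f, g) \<in> graph_mod A (\<lambda>f. t (s f)) B"
    using vec.subspace_add[OF B *(3,2)] *(1) by (simp only: mem_graph_mod)
next
  fix f g assume "(f, g) \<in> graph_mod A (\<lambda>f. t (s f)) B"
  then have "(f, s f) \<in> graph_mod A s B" "(s f, g) \<in> graph_mod A t B"
    using sA by (auto simp: vec.subspace_0[OF B])
  then show "(f, g) \<in> graph_mod A s B O graph_mod A t B"
    by blast
qed

context
  fixes W :: "'i set" and A B :: "('i \<Rightarrow> 'a::field) set" and t
  assumes A: "space_on W A" and B: "space_on W B" and BA: "B \<subseteq> A"
    and t: "vlinear t" and tA: "t ` A \<subseteq> A" and tB: "t ` B \<subseteq> B"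
begin

lemma genaut_power_graph_mod: "genaut_power W (graph_mod A t B) i = graph_mod A (t ^^ i) B"
proof -
  have subs: "vec.subspace A" "vec.subspace B"
    using A B by (auto simp: space_on_def)
  have step: "graph_mod A (t ^^ i) B O graph_mod A t B = graph_mod A (t ^^ Suc i) B" for i
  proof -
    have "(t ^^ i) f \<in> A" if "f \<in> A" for f
      using that tA by (induction i) auto
    then have "graph_mod A (t ^^ i) B O graph_mod A t B = graph_mod A (\<lambda>f. t ((t ^^ i) f)) B"
      by (intro graph_mod_O subs BA t tB) auto
    then show ?thesis
      by (simp add: o_def)
  qed
  \<comment> \<open>Adding \<open>A \<times> B\<close> cuts the identity on all vectors over \<open>W\<close> down to \<open>A\<close> and blurs it by \<open>B\<close>.\<close>
  have "genaut_add (Id_on (vectors_on W)) (A \<times> B) = graph_mod A id B"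
  proof (intro set_eqI iffI; clarify)
    fix f g assume "(f, g) \<in> genaut_add (Id_on (vectors_on W)) (A \<times> B)"
    then show "(f, g) \<in> graph_mod A id B"
      by (auto simp: genaut_add_def)
  next
    fix f g assume "(f, g) \<in> graph_mod A id B"
    then have "(f, f) \<in> Id_on (vectors_on W)" "(f, g - f) \<in> A \<times> B"
      using A by (auto simp: space_on_def)
    then have "(f, f + (g - f)) \<in> genaut_add (Id_on (vectors_on W)) (A \<times> B)"
      unfolding genaut_add_def by blast
    then show "(f, g) \<in> genaut_add (Id_on (vectors_on W)) (A \<times> B)"
      by simp
  qed
  then have zero: "genaut_power W (graph_mod A t B) 0 = graph_mod A id B"
    by (simp add: Domain_graph_mod kerD_graph_mod subs t)
  have "genaut_power W (graph_mod A t B) (Suc i) = graph_mod A (t ^^ Suc i) B" for i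
  proof (induction i)
    case (Suc i)
    then show ?case
      using step[of "Suc i"] by (simp del: funpow.simps)
  qed simp
  with zero show ?thesis
    by (cases i) (simp_all add: id_def)
qed

lemma genaut_poly_graph_mod: "genaut_poly W p (graph_mod A t B) = graph_mod A (poly_op p t) B"
proof -
  interpret vector_space_pair vscale vscale
    by unfold_locales
  have subs: "vec.subspace A" "vec.subspace B"
    using A B by (auto simp: space_on_def)
  have lin: "vlinear (t ^^ i)" for i
    by (rule vlinear_funpow[OF t])
  have "genaut_poly_upto W p (graph_mod A t B) n
      = graph_mod A (\<lambda>f. \<Sum>i\<le>n. vscale (coeff p i) ((t ^^ i) f)) B" for n
  proof (induction n)
    case 0
    show ?case
      by (simp only: genaut_poly_upto.simps genaut_power_graph_mod
          genaut_scale_graph_mod[OF subs lin]) simp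
  next
    case (Suc n)
    then show ?case
      by (simp only: genaut_poly_upto.simps genaut_power_graph_mod
          genaut_scale_graph_mod[OF subs lin] genaut_add_graph_mod[OF subs(2)] sum.atMost_Suc)
  qed
  then show ?thesis
    by (simp add: genaut_poly_def poly_op_def[abs_def])
qed

end

section \<open>Restriction to an invariant space and passage to the quotient\<close>

text \<open>
  A pair in the graph modulo \<open>B\<close> whose first component lies in \<open>U\<close> has its second one there too,
  so bounding the second component costs nothing.
\<close>

lemma graph_mod_restrict:
  assumes U: "vec.subspace U" and "B \<subseteq> U" "U \<subseteq> A" and sU: "s ` U \<subseteq> U"
  shows "graph_mod U s B = graph_mod A s B \<inter> (U \<times> U)"
proof -
  have "g \<in> U" if "f \<in> U" "g - s f \<in> B" for f g
  proof -
    have "(g - s f) + s f \<in> U"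
      using that assms by (intro vec.subspace_add[OF U]) auto
    then show ?thesis
      by simp
  qed
  then show ?thesis
    using \<open>U \<subseteq> A\<close> by auto
qed

lemma plusD_graph_mod:
  assumes B: "vec.subspace B" and U: "vec.subspace U" and "B \<subseteq> U"
  shows "plusD (graph_mod A s B) U = graph_mod A s U"
proof (intro set_eqI iffI; clarify)
  fix f g assume "(f, g) \<in> plusD (graph_mod A s B) U"
  then obtain h u where g: "g = h + u" and "f \<in> A" and *: "h - s f \<in> U" "u \<in> U"
    using \<open>B \<subseteq> U\<close> unfolding plusD_def set_plus_def graph_mod_def by auto
  have "(h - s f) + u = g - s f"
    by (simp add: g)
  then show "(f, g) \<in> graph_mod A s U"
    using vec.subspace_add[OF U *] \<open>f \<in> A\<close> by (simp only: mem_graph_mod)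
next
  fix f g assume "(f, g) \<in> graph_mod A s U"
  then have "(f, s f) + (0, g - s f) \<in> plusD (graph_mod A s B) U"
    unfolding plusD_def by (intro set_plus_intro) (auto simp: vec.subspace_0[OF B])
  then show "(f, g) \<in> plusD (graph_mod A s B) U"
    by simp
qed

text \<open>
  Enlarging the summand from \<open>{0} \<times> U\<close> to \<open>U \<times> U\<close> changes nothing, because \<open>s\<close> maps \<open>U\<close> to \<open>U\<close>:
  the image of a first component in \<open>U\<close> is already zero modulo \<open>U\<close>.
\<close>

lemma graph_mod_plus_square:
  assumes A: "vec.subspace A" and B: "vec.subspace B" and U: "vec.subspace U"
    and "B \<subseteq> U" "U \<subseteq> A" and s: "vlinear s" and sU: "s ` U \<subseteq> U"
  shows "graph_mod A s B + U \<times> U = graph_mod A s U"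
proof
  interpret s: Vector_Spaces.linear vscale vscale s
    by (rule s)
  have "graph_mod A s B \<subseteq> graph_mod A s U"
    using \<open>B \<subseteq> U\<close> by auto
  moreover have "U \<times> U \<subseteq> graph_mod A s U"
  proof clarify
    fix f g assume "f \<in> U" "g \<in> U"
    then have "f \<in> A" "s f \<in> U"
      using \<open>U \<subseteq> A\<close> sU by auto
    then show "(f, g) \<in> graph_mod A s U"
      using vec.subspace_diff[OF U \<open>g \<in> U\<close>] by (simp only: mem_graph_mod)
  qed
  ultimately show "graph_mod A s B + U \<times> U \<subseteq> graph_mod A s U"
    using pvec.subspace_add[OF subspace_graph_mod[OF A U s]]
    unfolding set_plus_def by blast
  have "plusD (graph_mod A s B) U \<subseteq> graph_mod A s B + U \<times> U"
    unfolding plusD_def using vec.subspace_0[OF U] by (intro set_plus_mono2) auto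
  then show "graph_mod A s U \<subseteq> graph_mod A s B + U \<times> U"
    by (simp add: plusD_graph_mod B U \<open>B \<subseteq> U\<close>)
qed

theorem theorem58:
  fixes W :: "'i set"
    and Vl V :: "('i, 'a::field) genaut"
    and U :: "('i \<Rightarrow> 'a) set"
    and p p1 p2 :: "'a poly"
  assumes "finite W"
    and "LSG W Vl"
    and "genop W V"
    and "Vl \<subseteq> V"
    and "kerD V = kerD Vl"
    and "invariant_in W U Vl"
  shows "(meetW Vl U = V \<inter> (U \<times> U) \<and> genop W (meetW Vl U))
    \<and> (invariant_in W U V \<and> plusD V U = V + U \<times> U \<and> genop W (plusD V U))
    \<and> genaut_poly W p (meetW Vl U) = genaut_poly W p V \<inter> (U \<times> U)
    \<and> (genaut_poly W p (plusD V U) = plusD (genaut_poly W p V) U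
        \<and> plusD (genaut_poly W p V) U = genaut_poly W p V + U \<times> U)
    \<and> (decoupled W (genaut_poly W p V) \<longrightarrow>
        decoupled W (genaut_poly W p (meetW Vl U)) \<and> decoupled W (genaut_poly W p (plusD V U)))
    \<and> (decoupled W (genaut_poly W p1 (meetW Vl U)) \<and> decoupled W (genaut_poly W p2 (plusD V U)) \<longrightarrow>
        decoupled W (genaut_poly W (p1 * p2) V))"
proof -
  have gV: "is_genaut W V" and sV: "pvec.subspace V" and sVl: "pvec.subspace Vl"
    using assms(2,3) by (auto simp: genop_def USG_def LSG_def is_genaut_def)
  have spU: "space_on W U" and U: "vec.subspace U"
    and cond: "\<And>f g. f \<in> U \<Longrightarrow> (f, g) \<in> Vl \<Longrightarrow> g \<in> U"
    and ctrl: "\<And>f. f \<in> U \<Longrightarrow> \<exists>g\<in>U. (f, g) \<in> Vl"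
    using assms(6)
    by (auto simp: invariant_in_def space_on_def cond_invariant_def ctrl_invariant_def)
  define D where "D = Domain V"
  define K where "K = kerD V"
  obtain t where t: "vlinear t" and V: "V = graph_mod D t K"
    and tD: "t ` D \<subseteq> D" and tK: "t ` K \<subseteq> K"
    using genop_as_graph_mod[OF assms(3)] unfolding D_def K_def by blast
  have D: "vec.subspace D" and K: "vec.subspace K"
    using subspace_Domain[OF sV] subspace_kerD[OF sV] by (auto simp: D_def K_def)
  \<comment> \<open>Conditioned invariance applied to \<open>0 \<in> U\<close>; it is stated for \<open>Vl\<close>, which shares \<open>K\<close> with \<open>V\<close>.\<close>
  have KU: "K \<subseteq> U"
    using cond[OF vec.subspace_0[OF U]] unfolding K_def assms(5) by (auto simp: kerD_def)
  have UD: "U \<subseteq> D"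
    using ctrl assms(4) by (auto simp: D_def)
  have spD: "space_on W D"
    using gV D by (auto simp: space_on_def is_genaut_def D_def)
  have spK: "space_on W K"
    using spU K KU by (auto simp: space_on_def)
  \<comment> \<open>A vector of \<open>U\<close> has some successor in \<open>U\<close>, and \<open>t\<close> gives the same one up to \<open>K \<subseteq> U\<close>.\<close>
  have tU: "t ` U \<subseteq> U"
  proof clarify
    fix f assume "f \<in> U"
    then obtain g where g: "g \<in> U" "(f, g) \<in> Vl"
      using ctrl by blast
    then have "(f, g) \<in> graph_mod D t K"
      using assms(4) V by blast
    then have "g - t f \<in> U"
      using KU by (simp only: mem_graph_mod) blast
    then have "g - (g - t f) \<in> U"
      by (rule vec.subspace_diff[OF U g(1)])
    then show "t f \<in> U"
      by simp
  qed
  have sU: "poly_op q t ` U \<subseteq> U" for q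
    by (rule poly_op_closed[OF U tU])
  note lin = vlinear_poly_op[OF t]

  have M: "meetW Vl U = graph_mod U t K"
  proof (intro set_eqI iffI; clarify)
    fix f g assume "(f, g) \<in> meetW Vl U"
    then show "(f, g) \<in> graph_mod U t K"
      using assms(4) unfolding V by (auto simp: meetW_def)
  next
    fix f g assume fg: "(f, g) \<in> graph_mod U t K"
    then obtain h where h: "(f, h) \<in> Vl"
      using ctrl by auto
    \<comment> \<open>All successors of \<open>f\<close> in \<open>V\<close> differ by elements of the common \<open>K\<close>, so one in \<open>Vl\<close> suffices.\<close>
    have "(f, g) \<in> V" "(f, h) \<in> V"
      using fg h UD assms(4) by (auto simp: V)
    then have "(0, g - h) \<in> Vl"
      using diff_in_kerD[OF sV] assms(5) by (auto simp: kerD_def)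
    then have "(f, h) + (0, g - h) \<in> Vl"
      by (rule pvec.subspace_add[OF sVl h])
    then show "(f, g) \<in> meetW Vl U"
      using fg by (simp add: meetW_def)
  qed
  have P: "plusD V U = graph_mod D t U"
    unfolding V by (rule plusD_graph_mod[OF K U KU])

  have pV: "genaut_poly W q V = graph_mod D (poly_op q t) K" for q
    using genaut_poly_graph_mod[OF spD spK _ t tD tK] KU UD by (simp add: V)
  have pM: "genaut_poly W q (meetW Vl U) = graph_mod U (poly_op q t) K" for q
    unfolding M by (rule genaut_poly_graph_mod[OF spU spK KU t tU tK])
  have pP: "genaut_poly W q (plusD V U) = graph_mod D (poly_op q t) U" for q
    unfolding P by (rule genaut_poly_graph_mod[OF spD spU UD t tD tU])

  have "meetW Vl U = V \<inter> (U \<times> U)"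
    unfolding M V by (rule graph_mod_restrict[OF U KU UD tU])
  moreover have "genop W (meetW Vl U)"
    unfolding M by (rule genop_graph_mod[OF spU spK KU t tU tK])
  moreover have "invariant_in W U V"
    unfolding invariant_in_def
  proof (intro conjI spU)
    show "cond_invariant U V"
    proof (clarsimp simp: cond_invariant_def)
      fix f g assume "f \<in> U" "(f, g) \<in> V"
      then have "(f, g) \<in> graph_mod U t K"
        by (simp add: V)
      then show "g \<in> U"
        by (rule graph_mod_range[OF spU spK KU tU])
    qed
    show "ctrl_invariant U V"
      using ctrl assms(4) by (fastforce simp: ctrl_invariant_def)
  qed
  moreover have "plusD V U = V + U \<times> U"
    unfolding P using graph_mod_plus_square[OF D K U KU UD t tU] by (simp add: V)
  moreover have "genop W (plusD V U)"
    unfolding P by (rule genop_graph_mod[OF spD spU UD t tD tU])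
  moreover have "genaut_poly W p (meetW Vl U) = genaut_poly W p V \<inter> (U \<times> U)"
    unfolding pM pV by (rule graph_mod_restrict[OF U KU UD sU])
  moreover have "genaut_poly W p (plusD V U) = plusD (genaut_poly W p V) U"
    unfolding pP pV by (rule plusD_graph_mod[OF K U KU, symmetric])
  moreover have "plusD (genaut_poly W p V) U = genaut_poly W p V + U \<times> U"
    unfolding pV plusD_graph_mod[OF K U KU]
    by (rule graph_mod_plus_square[OF D K U KU UD lin sU, symmetric])
  moreover have "decoupled W (genaut_poly W p (meetW Vl U))
      \<and> decoupled W (genaut_poly W p (plusD V U))" if "decoupled W (genaut_poly W p V)"
    using that KU UD unfolding pV pM pP
    by (auto simp: decoupled_graph_mod_iff lin spU spD spK)
  moreover have "decoupled W (genaut_poly W (p1 * p2) V)"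
    if "decoupled W (genaut_poly W p1 (meetW Vl U))" "decoupled W (genaut_poly W p2 (plusD V U))"
    using that unfolding pV pM pP
    by (auto simp: decoupled_graph_mod_iff lin spU spD spK poly_op_mult[OF t])
  ultimately show ?thesis
    by blast
qed

end
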